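(* Let $d\ge 1$ and $\boldsymbol{p}\in[0,1]^d$. The class $\mathcal{B}_d^{\Sigma}(\boldsymbol{p})$ of $\Sigma$-countermonotonic pmfs in $\mathcal{B}_d(\boldsymbol{p})$ is a convex polytope, and its extremal points are exactly the extremal points of $\mathcal{B}_d(\boldsymbol{p})$ that are $\Sigma$-countermonotonic.
   Context: $\mathcal{B}_d(\boldsymbol{p})$ is the class of probability mass functions (pmfs) on $\{0,1\}^d$ whose $j$-th one-dimensional marginal is Bernoulli with mean $p_j$, $j=1,\dots,d$. A pmf on $\{0,1\}^d$ is regarded as a vector in $\mathbb{R}^{2^d}$; $\mathcal{B}_d(\boldsymbol{p})$ is a convex polytope. A convex polytope is the convex hull of a finite set of points, and its extremal points are its vertices (extreme points). Two real random variables $X,Y$ on a probability space $(\Omega,\mathcal{F},\mathbb{P})$ are countermonotonic if $(X(\omega)-X(\omega'))(Y(\omega)-Y(\omega'))\le 0$ for $(\mathbb{P}\times\mathbb{P})$-almost every $(\omega,\omega')\in\Omega^2$. A Bernoulli random vector $\boldsymbol{I}=(I_1,\dots,I_d)$ (or its pmf) is $\Sigma$-countermonotonic if for every $\Lambda\subseteq\{1,\dots,d\}$ the random variables $\sum_{j\in\Lambda}I_j$ and $\sum_{j\notin\Lambda}I_j$ are countermonotonic (with $\sum_{j\in\varnothing}I_j=0$). *)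

theory Defs
  imports "HOL-Probability.Probability"
begin

text \<open>
  The index set {1,...,d} is a finite type \<open>'d\<close> (so d is at least 1 automatically), and a point of
  {0,1}^d is a vector of type \<open>bool ^ 'd\<close>, with \<open>True\<close> for 1.
\<close>

definition countermonotonic :: "'a measure \<Rightarrow> ('a \<Rightarrow> real) \<Rightarrow> ('a \<Rightarrow> real) \<Rightarrow> bool" where
  "countermonotonic M X Y \<longleftrightarrow>
     (AE (\<omega>, \<omega>') in M \<Otimes>\<^sub>M M. (X \<omega> - X \<omega>') * (Y \<omega> - Y \<omega>') \<le> 0)"

definition sigma_countermonotonic :: "'a measure \<Rightarrow> ('a \<Rightarrow> bool ^ 'd::finite) \<Rightarrow> bool" where
  "sigma_countermonotonic M I \<longleftrightarrow>
     (\<forall>\<Lambda> :: 'd set. countermonotonic M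
        (\<lambda>\<omega>. \<Sum>j\<in>\<Lambda>. of_bool (I \<omega> $ j)) (\<lambda>\<omega>. \<Sum>j\<in>- \<Lambda>. of_bool (I \<omega> $ j)))"

text \<open>
  A pmf is \<open>\<Sigma>\<close>-countermonotonic if the identity random vector on {0,1}^d, which has this pmf
  as its law, is. The property depends only on the law of the random vector.
\<close>

definition sigma_countermonotonic_pmf :: "(bool ^ 'd::finite) pmf \<Rightarrow> bool" where
  "sigma_countermonotonic_pmf f \<longleftrightarrow> sigma_countermonotonic (measure_pmf f) (\<lambda>x. x)"

definition bernoulli_class :: "real ^ 'd::finite \<Rightarrow> (bool ^ 'd) pmf set" where
  "bernoulli_class p = {f. \<forall>j. map_pmf (\<lambda>x. x $ j) f = bernoulli_pmf (p $ j)}"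

definition sigma_bernoulli_class :: "real ^ 'd::finite \<Rightarrow> (bool ^ 'd) pmf set" where
  "sigma_bernoulli_class p = {f \<in> bernoulli_class p. sigma_countermonotonic_pmf f}"

text \<open>A pmf on {0,1}^d as a vector in the Euclidean space of dimension 2^d.\<close>

definition pmf_vec :: "(bool ^ 'd::finite) pmf \<Rightarrow> real ^ (bool ^ 'd)" where
  "pmf_vec f = (\<chi> x. pmf f x)"

end

theory Submission
  imports Defs
begin

text \<open>
  Write \<open>S x\<close> for the number of coordinates of \<open>x\<close> that are \<open>True\<close>, and \<open>m\<close> for the sum of the
  \<open>p $ j\<close>, which is the mean of \<open>S\<close> under every pmf in \<open>bernoulli_class p\<close>.
  Countermonotonicity over all splittings of the index set is a condition on pairs of points of the
  support, and it amounts to saying that \<open>S\<close> varies by at most 1 on the support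
  (\<open>sigma_countermonotonic_pmf_iff\<close>). Since the mean of \<open>S\<close> is prescribed, the possible values of
  \<open>S\<close> are then prescribed as well: they are those at distance less than 1 from \<open>m\<close>
  (\<open>sigma_countermonotonic_pmf_iff_near_mean\<close>). Hence the \<open>\<Sigma>\<close>-countermonotonic pmfs in the class
  are those giving no mass to a fixed set of points. As masses are nonnegative, this cuts out a face
  of the polytope of all pmfs in the class, and a face of a polytope is a polytope whose extreme
  points are the extreme points of the whole polytope that it contains.
\<close>

definition true_count :: "bool ^ 'd::finite \<Rightarrow> real" where
  "true_count x = (\<Sum>j\<in>UNIV. of_bool (x $ j))"

lemma true_count_Int: "true_count x \<in> \<int>"
  unfolding true_count_def by (intro Ints_sum) auto

section \<open>Countermonotonicity as a condition on the support\<close>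

lemma AE_measure_pmf_pair_iff:
  fixes f :: "'a::countable pmf"
  shows "(AE z in measure_pmf f \<Otimes>\<^sub>M measure_pmf f. Q z) \<longleftrightarrow>
    (\<forall>x\<in>set_pmf f. \<forall>y\<in>set_pmf f. Q (x, y))"
proof -
  interpret pair_sigma_finite "measure_pmf f" "measure_pmf f" ..
  have sets: "sets (measure_pmf f \<Otimes>\<^sub>M measure_pmf f) = UNIV"
    using sets_pair_countable[of UNIV UNIV "measure_pmf f" "measure_pmf f"] by simp
  show ?thesis
  proof
    assume "AE z in measure_pmf f \<Otimes>\<^sub>M measure_pmf f. Q z"
    from AE_pair[OF this] show "\<forall>x\<in>set_pmf f. \<forall>y\<in>set_pmf f. Q (x, y)"
      by (simp add: AE_measure_pmf_iff)
  next
    assume "\<forall>x\<in>set_pmf f. \<forall>y\<in>set_pmf f. Q (x, y)"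
    then show "AE z in measure_pmf f \<Otimes>\<^sub>M measure_pmf f. Q z"
      by (intro AE_pair_measure) (auto simp: AE_measure_pmf_iff sets)
  qed
qed

text \<open>
  Two integers of the same strict sign have a sum of absolute value at least 2. Conversely, if \<open>x\<close>
  has two more true coordinates than \<open>y\<close>, then splitting off a single coordinate in which \<open>x\<close>
  exceeds \<open>y\<close> leaves a positive excess on both sides.
\<close>

lemma all_splits_opposite_iff:
  fixes x y :: "bool ^ 'd::finite"
  shows "(\<forall>\<Lambda>. ((\<Sum>j\<in>\<Lambda>. of_bool (x $ j)) - (\<Sum>j\<in>\<Lambda>. of_bool (y $ j))) *
      ((\<Sum>j\<in>-\<Lambda>. of_bool (x $ j)) - (\<Sum>j\<in>-\<Lambda>. of_bool (y $ j))) \<le> (0::real)) \<longleftrightarrow>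
    \<bar>true_count x - true_count y\<bar> \<le> 1" (is "?L \<longleftrightarrow> ?R")
proof -
  define D where "D \<Lambda> x y = (\<Sum>j\<in>\<Lambda>. of_bool (x $ j)) - (\<Sum>j\<in>\<Lambda>. of_bool (y $ j) :: real)"
    for \<Lambda> and x y :: "bool ^ 'd"
  have D_split: "true_count x - true_count y = D \<Lambda> x y + D (-\<Lambda>) x y" for \<Lambda> x y
    using sum.subset_diff[of \<Lambda> UNIV "\<lambda>j. of_bool (x $ j) :: real"]
      sum.subset_diff[of \<Lambda> UNIV "\<lambda>j. of_bool (y $ j) :: real"]
    by (simp add: D_def true_count_def Compl_eq_Diff_UNIV)
  have D_commute: "D \<Lambda> x y = - D \<Lambda> y x" for \<Lambda> x y
    by (simp add: D_def)
  have excess: "\<exists>\<Lambda>. D \<Lambda> x y * D (-\<Lambda>) x y > 0" if gt: "true_count x - true_count y > 1" for x y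
  proof -
    have "\<exists>j. x $ j \<and> \<not> y $ j"
    proof (rule ccontr)
      assume "\<not> ?thesis"
      then have "true_count x \<le> true_count y"
        unfolding true_count_def by (intro sum_mono) auto
      with gt show False by simp
    qed
    then obtain j where "x $ j" "\<not> y $ j" by blast
    then have "D {j} x y = 1" by (simp add: D_def)
    moreover from this have "D (-{j}) x y > 0"
      using gt D_split[of x y "{j}"] by linarith
    ultimately have "D {j} x y * D (-{j}) x y > 0" by simp
    then show ?thesis by blast
  qed
  have "?L \<longleftrightarrow> (\<forall>\<Lambda>. D \<Lambda> x y * D (-\<Lambda>) x y \<le> 0)"
    by (simp add: D_def)
  also have "\<dots> \<longleftrightarrow> ?R"
  proof
    assume L: "\<forall>\<Lambda>. D \<Lambda> x y * D (-\<Lambda>) x y \<le> 0"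
    have "D \<Lambda> y x * D (-\<Lambda>) y x = D \<Lambda> x y * D (-\<Lambda>) x y" for \<Lambda>
      by (simp add: D_commute[of _ y x])
    with L excess[of x y] excess[of y x]
    have "\<not> true_count x - true_count y > 1" "\<not> true_count y - true_count x > 1"
      by (auto simp: not_less[symmetric])
    then show ?R by linarith
  next
    assume R: ?R
    show "\<forall>\<Lambda>. D \<Lambda> x y * D (-\<Lambda>) x y \<le> 0"
    proof (rule allI, rule ccontr)
      fix \<Lambda> assume "\<not> D \<Lambda> x y * D (-\<Lambda>) x y \<le> 0"
      then have same_sign: "D \<Lambda> x y > 0 \<and> D (-\<Lambda>) x y > 0 \<or> D \<Lambda> x y < 0 \<and> D (-\<Lambda>) x y < 0"
        by (simp add: not_le zero_less_mult_iff)
      have "D \<Lambda>' x y \<in> \<int>" for \<Lambda>'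
        unfolding D_def by (intro Ints_diff Ints_sum) auto
      then have "\<bar>D \<Lambda>' x y\<bar> \<ge> 1" if "D \<Lambda>' x y \<noteq> 0" for \<Lambda>'
        using that Ints_nonzero_abs_ge1 by blast
      from this[of \<Lambda>] this[of "-\<Lambda>"] same_sign R D_split[of x y \<Lambda>] show False
        by linarith
    qed
  qed
  finally show ?thesis .
qed

lemma sigma_countermonotonic_pmf_iff:
  "sigma_countermonotonic_pmf f \<longleftrightarrow>
    (\<forall>x\<in>set_pmf f. \<forall>y\<in>set_pmf f. \<bar>true_count x - true_count y\<bar> \<le> 1)"
  unfolding sigma_countermonotonic_pmf_def sigma_countermonotonic_def countermonotonic_def
    AE_measure_pmf_pair_iff all_splits_opposite_iff[symmetric]
  by auto

section \<open>Prescribed marginals\<close>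

lemma bernoulli_class_iff:
  fixes p :: "real ^ 'd::finite"
  assumes p: "\<forall>j. 0 \<le> p $ j \<and> p $ j \<le> 1"
  shows "f \<in> bernoulli_class p \<longleftrightarrow> (\<forall>j. (\<Sum>x\<in>UNIV. of_bool (x $ j) * pmf f x) = p $ j)"
proof -
  have marginal: "pmf (map_pmf (\<lambda>x. x $ j) f) True = (\<Sum>x\<in>UNIV. of_bool (x $ j) * pmf f x)" for j
  proof -
    have "pmf (map_pmf (\<lambda>x. x $ j) f) True = sum (pmf f) {x. x $ j}"
      by (simp add: pmf_map vimage_def measure_measure_pmf_finite)
    also have "\<dots> = (\<Sum>x\<in>UNIV. of_bool (x $ j) * pmf f x)"
      by (rule sum.mono_neutral_cong_left) auto
    finally show ?thesis .
  qed
  have "map_pmf (\<lambda>x. x $ j) f = bernoulli_pmf (p $ j) \<longleftrightarrow>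
      pmf (map_pmf (\<lambda>x. x $ j) f) True = p $ j" for j
  proof
    assume "pmf (map_pmf (\<lambda>x. x $ j) f) True = p $ j"
    with p have "pmf (map_pmf (\<lambda>x. x $ j) f) b = pmf (bernoulli_pmf (p $ j)) b" for b
      by (cases b) (simp_all add: pmf_False_conv_True)
    then show "map_pmf (\<lambda>x. x $ j) f = bernoulli_pmf (p $ j)"
      by (rule pmf_eqI)
  qed (use p in simp)
  then show ?thesis
    by (simp add: bernoulli_class_def marginal)
qed

lemma sum_true_count_bernoulli_class:
  fixes p :: "real ^ 'd::finite"
  assumes "\<forall>j. 0 \<le> p $ j \<and> p $ j \<le> 1" and "f \<in> bernoulli_class p"
  shows "(\<Sum>x\<in>UNIV. pmf f x * true_count x) = (\<Sum>j\<in>UNIV. p $ j)"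
proof -
  have "(\<Sum>x\<in>UNIV. pmf f x * true_count x) = (\<Sum>x\<in>UNIV. \<Sum>j\<in>UNIV. of_bool (x $ j) * pmf f x)"
    unfolding true_count_def by (simp add: sum_distrib_left mult.commute[of "pmf f _"])
  also have "\<dots> = (\<Sum>j\<in>UNIV. \<Sum>x\<in>UNIV. of_bool (x $ j) * pmf f x)"
    by (rule sum.swap)
  also have "\<dots> = (\<Sum>j\<in>UNIV. p $ j)"
    using assms bernoulli_class_iff by (intro sum.cong) auto
  finally show ?thesis .
qed

text \<open>
  If \<open>g\<close> varies by at most 1 on the support and takes there a value at least 1 above its mean, then
  all its values are at least the mean, one of them strictly, which is absurd.
\<close>

lemma less_mean_plus_1:
  fixes f :: "'a::finite pmf" and g :: "'a \<Rightarrow> real"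
  assumes mean: "(\<Sum>y\<in>UNIV. pmf f y * g y) = m"
    and x: "x \<in> set_pmf f"
    and narrow: "\<And>y. y \<in> set_pmf f \<Longrightarrow> g x - g y \<le> 1"
  shows "g x < m + 1"
proof (rule ccontr)
  assume "\<not> g x < m + 1"
  then have above: "g x \<ge> m + 1" by simp
  have nonneg: "pmf f y * (g y - m) \<ge> 0" for y
  proof (cases "y \<in> set_pmf f")
    case True
    with narrow[of y] above show ?thesis by (intro mult_nonneg_nonneg) auto
  qed (simp add: set_pmf_iff)
  have "(\<Sum>y\<in>UNIV. pmf f y * (g y - m)) = 0"
    using mean sum_pmf_eq_1[of UNIV f]
    by (simp add: right_diff_distrib sum_subtractf flip: sum_distrib_right)
  with nonneg have "pmf f x * (g x - m) = 0"
    by (subst (asm) sum_nonneg_eq_0_iff) auto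
  with x above show False by (simp add: pmf_eq_0_set_pmf)
qed

text \<open>
  For the forward direction the mean bounds \<open>true_count\<close> from above and, applied to its negative,
  from below; conversely, integers in an open interval of length 2 differ by at most 1.
\<close>

lemma sigma_countermonotonic_pmf_iff_near_mean:
  fixes p :: "real ^ 'd::finite"
  assumes p: "\<forall>j. 0 \<le> p $ j \<and> p $ j \<le> 1" and f: "f \<in> bernoulli_class p"
  shows "sigma_countermonotonic_pmf f \<longleftrightarrow>
    (\<forall>x\<in>set_pmf f. \<bar>true_count x - (\<Sum>j\<in>UNIV. p $ j)\<bar> < 1)"
proof
  let ?m = "\<Sum>j\<in>UNIV. p $ j"
  note mean = sum_true_count_bernoulli_class[OF p f]
  assume "sigma_countermonotonic_pmf f"
  then have narrow: "\<bar>true_count x - true_count y\<bar> \<le> 1" if "x \<in> set_pmf f" "y \<in> set_pmf f" for x y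
    using that by (simp add: sigma_countermonotonic_pmf_iff)
  show "\<forall>x\<in>set_pmf f. \<bar>true_count x - ?m\<bar> < 1"
  proof
    fix x assume x: "x \<in> set_pmf f"
    have "true_count x < ?m + 1"
      using narrow[OF x] by (intro less_mean_plus_1[OF mean x]) fastforce
    moreover have "- true_count x < - ?m + 1"
      using narrow[OF x] mean
      by (intro less_mean_plus_1[of f "\<lambda>x. - true_count x", OF _ x]) (fastforce simp: sum_negf)+
    ultimately show "\<bar>true_count x - ?m\<bar> < 1" by linarith
  qed
next
  let ?m = "\<Sum>j\<in>UNIV. p $ j"
  assume near: "\<forall>x\<in>set_pmf f. \<bar>true_count x - ?m\<bar> < 1"
  show "sigma_countermonotonic_pmf f"
    unfolding sigma_countermonotonic_pmf_iff
  proof (intro ballI)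
    fix x y assume "x \<in> set_pmf f" "y \<in> set_pmf f"
    with near have "\<bar>true_count x - ?m\<bar> < 1" "\<bar>true_count y - ?m\<bar> < 1" by auto
    then have "\<bar>true_count x - true_count y\<bar> < 2" by linarith
    moreover have "true_count x - true_count y \<in> \<int>"
      by (intro Ints_diff true_count_Int)
    then obtain k where k: "true_count x - true_count y = of_int k"
      by (rule Ints_cases)
    ultimately have "real_of_int \<bar>k\<bar> < real_of_int 2" by simp
    then have "\<bar>k\<bar> \<le> 1" by (simp only: of_int_less_iff)
    then have "real_of_int \<bar>k\<bar> \<le> real_of_int 1" by (simp only: of_int_le_iff)
    with k show "\<bar>true_count x - true_count y\<bar> \<le> 1" by simp
  qed
qed

section \<open>The polytope and its face\<close>

lemma inj_pmf_vec: "inj pmf_vec"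
  by (rule injI, rule pmf_eqI) (metis pmf_vec_def vec_lambda_beta)

lemma range_pmf_vec:
  "range pmf_vec = {v. (\<forall>x. 0 \<le> v $ x) \<and> (\<Sum>x\<in>UNIV. v $ x) = 1}"
proof (intro equalityI subsetI)
  fix v assume "v \<in> range pmf_vec"
  then show "v \<in> {v. (\<forall>x. 0 \<le> v $ x) \<and> (\<Sum>x\<in>UNIV. v $ x) = 1}"
    by (auto simp: pmf_vec_def sum_pmf_eq_1)
next
  fix v :: "real ^ (bool ^ 'a)"
  assume v: "v \<in> {v. (\<forall>x. 0 \<le> v $ x) \<and> (\<Sum>x\<in>UNIV. v $ x) = 1}"
  then have "(\<integral>\<^sup>+ x. ennreal (v $ x) \<partial>count_space UNIV) = 1"
    by (simp add: nn_integral_count_space_finite sum_ennreal)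
  with v have "v = pmf_vec (embed_pmf (\<lambda>x. v $ x))"
    by (simp add: pmf_vec_def pmf_embed_pmf vec_eq_iff)
  then show "v \<in> range pmf_vec" by blast
qed

lemma pmf_vec_bernoulli_class:
  fixes p :: "real ^ 'd::finite"
  assumes "\<forall>j. 0 \<le> p $ j \<and> p $ j \<le> 1"
  shows "pmf_vec ` bernoulli_class p =
    {v. (\<forall>x. 0 \<le> v $ x) \<and> (\<Sum>x\<in>UNIV. v $ x) = 1 \<and>
        (\<forall>j. (\<Sum>x\<in>UNIV. of_bool (x $ j) * v $ x) = p $ j)}"
proof -
  have "pmf_vec ` bernoulli_class p =
      range pmf_vec \<inter> {v. \<forall>j. (\<Sum>x\<in>UNIV. of_bool (x $ j) * v $ x) = p $ j}"
    by (auto simp: bernoulli_class_iff[OF assms] pmf_vec_def)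
  then show ?thesis by (auto simp: range_pmf_vec)
qed

lemma polytope_bernoulli_class:
  fixes p :: "real ^ 'd::finite"
  assumes "\<forall>j. 0 \<le> p $ j \<and> p $ j \<le> 1"
  shows "polytope (pmf_vec ` bernoulli_class p)"
proof -
  let ?a = "\<lambda>j. (\<chi> x. of_bool (x $ j)) :: real ^ (bool ^ 'd)"
  have eq: "pmf_vec ` bernoulli_class p =
      (\<Inter>x. {v. axis x 1 \<bullet> v \<ge> 0}) \<inter> {v. (\<chi> x. 1) \<bullet> v = 1} \<inter> (\<Inter>j. {v. ?a j \<bullet> v = p $ j})"
    unfolding pmf_vec_bernoulli_class[OF assms]
    by (auto simp: inner_axis' inner_vec_def[of "vec_lambda _"])
  have "polyhedron (pmf_vec ` bernoulli_class p)"
    unfolding eq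
    by (intro polyhedron_Int polyhedron_Inter)
      (auto intro: polyhedron_halfspace_ge polyhedron_hyperplane)
  moreover have "bounded (pmf_vec ` bernoulli_class p)"
    by (rule bounded_subset[of "cbox 0 1"])
      (auto simp: mem_box_cart pmf_vec_def pmf_le_1)
  ultimately show ?thesis by (simp add: polytope_eq_bounded_polyhedron)
qed

text \<open>
  The supporting hyperplane is given by the total mass of the points whose count of true coordinates
  is at distance at least 1 from its mean: this mass is nonnegative, and it vanishes exactly for the
  \<open>\<Sigma>\<close>-countermonotonic pmfs in the class.
\<close>

lemma sigma_bernoulli_class_face_of:
  fixes p :: "real ^ 'd::finite"
  assumes "\<forall>j. 0 \<le> p $ j \<and> p $ j \<le> 1"
  shows "(pmf_vec ` sigma_bernoulli_class p) face_of (pmf_vec ` bernoulli_class p)"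
proof -
  define far where "far = {x :: bool ^ 'd. \<bar>true_count x - (\<Sum>j\<in>UNIV. p $ j)\<bar> \<ge> 1}"
  define a :: "real ^ (bool ^ 'd)" where "a = (\<chi> x. of_bool (x \<in> far))"
  have mass: "a \<bullet> pmf_vec f = sum (pmf f) far" for f
  proof -
    have "a \<bullet> pmf_vec f = (\<Sum>x\<in>UNIV. of_bool (x \<in> far) * pmf f x)"
      by (simp add: inner_vec_def a_def pmf_vec_def)
    also have "\<dots> = sum (pmf f) far"
      by (rule sum.mono_neutral_cong_right) auto
    finally show ?thesis .
  qed
  have "sigma_countermonotonic_pmf f \<longleftrightarrow> a \<bullet> pmf_vec f = 0" if "f \<in> bernoulli_class p" for f
  proof -
    have "a \<bullet> pmf_vec f = 0 \<longleftrightarrow> (\<forall>x\<in>far. pmf f x = 0)"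
      by (simp add: mass sum_nonneg_eq_0_iff)
    then show ?thesis
      using sigma_countermonotonic_pmf_iff_near_mean[OF assms that]
      by (auto simp: far_def pmf_eq_0_set_pmf not_less[symmetric])
  qed
  then have "pmf_vec ` sigma_bernoulli_class p =
      (pmf_vec ` bernoulli_class p) \<inter> {v. a \<bullet> v = 0}"
    by (auto simp: sigma_bernoulli_class_def)
  moreover have "\<dots> face_of (pmf_vec ` bernoulli_class p)"
    using polytope_imp_convex[OF polytope_bernoulli_class[OF assms]]
    by (rule face_of_Int_supporting_hyperplane_ge) (auto simp: mass sum_nonneg)
  ultimately show ?thesis by simp
qed

theorem proposition4p2:
  fixes p :: "real ^ 'd::finite"
  assumes "\<forall>j. 0 \<le> p $ j \<and> p $ j \<le> 1"
  shows "polytope (pmf_vec ` sigma_bernoulli_class p) \<and>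
    {v. v extreme_point_of (pmf_vec ` sigma_bernoulli_class p)} =
    pmf_vec ` {f. pmf_vec f extreme_point_of (pmf_vec ` bernoulli_class p) \<and>
                  sigma_countermonotonic_pmf f}"
proof
  note face = sigma_bernoulli_class_face_of[OF assms]
  show "polytope (pmf_vec ` sigma_bernoulli_class p)"
    by (rule face_of_polytope_polytope[OF polytope_bernoulli_class[OF assms] face])
  have "{v. v extreme_point_of (pmf_vec ` sigma_bernoulli_class p)} =
      {v \<in> pmf_vec ` sigma_bernoulli_class p. v extreme_point_of (pmf_vec ` bernoulli_class p)}"
    using extreme_point_of_face[OF face] by blast
  also have "\<dots> = pmf_vec ` {f. pmf_vec f extreme_point_of (pmf_vec ` bernoulli_class p) \<and>
                  sigma_countermonotonic_pmf f}"
  proof -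
    have "f \<in> bernoulli_class p" if "pmf_vec f extreme_point_of (pmf_vec ` bernoulli_class p)" for f
      using that by (simp add: extreme_point_of_def inj_image_mem_iff[OF inj_pmf_vec])
    then show ?thesis by (auto simp: sigma_bernoulli_class_def)
  qed
  finally show "{v. v extreme_point_of (pmf_vec ` sigma_bernoulli_class p)} =
    pmf_vec ` {f. pmf_vec f extreme_point_of (pmf_vec ` bernoulli_class p) \<and>
                  sigma_countermonotonic_pmf f}" .
qed

end
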